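(* Let $N\ge 2$ be an integer and $\alpha\in(0,1)$. For $u=(v,a_2,\dots,a_{N+1})\in\mathcal{H}_\alpha(\mathbb{T})$, with $\bar v:=\int_0^1 v(x)\,dx$, set $$\|u\|_{\ast}^2:=\|u\|_{L^2(\mathbb{T},\mu)}^2+[v]_{H^\alpha(0,1)}^2+\lVert v-\bar v\rVert_{L^2(0,1)}^2+\sum_{k=2}^{N+1}\lvert a_k-\bar v\rvert^2 .$$ Then $\|\cdot\|_\ast$ is a norm on $\mathcal{H}_\alpha(\mathbb{T})$ that is equivalent to the norm $\|\cdot\|_{\mathcal{H}_\alpha(\mathbb{T})}$ given by $\|u\|_{\mathcal{H}_\alpha(\mathbb{T})}^2=\|u\|_{L^2(\mathbb{T},\mu)}^2+\mathcal{E}_\alpha(u)$.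
   Context: Let $D=\{2,3,\dots,N+1\}$ and $\mathbb{T}=[0,1]\cup D\subset\mathbb{R}$, with the positive finite Borel measure $\mu(A)=\int_{A\cap[0,1]}dx+\sum_{k=2}^{N+1}\delta_k(A)$, so that $\int_{\mathbb{T}} f\,d\mu=\int_0^1 f(x)\,dx+\sum_{k=2}^{N+1}f(k)$. A function $u:\mathbb{T}\to\mathbb{R}$ is written $u=(v,a_2,\dots,a_{N+1})$ with $v=u|_{[0,1]}$ and $a_k=u(k)$. The Gagliardo seminorm is $[v]_{H^\alpha(0,1)}^2=\int_0^1\int_0^1\frac{|v(x)-v(y)|^2}{|x-y|^{1+2\alpha}}\,dx\,dy$, and $H^\alpha(0,1)=\{v\in L^2(0,1):[v]_{H^\alpha(0,1)}<\infty\}$. The hybrid energy space is $\mathcal{H}_\alpha(\mathbb{T})=\{u=(v,a_2,\dots,a_{N+1}): v\in H^\alpha(0,1),\ a_k\in\mathbb{R}\}$ (functions identified when equal $\mu$-a.e.). The energy is $\mathcal{E}_\alpha(u)=\iint_{\mathbb{T}\times\mathbb{T}}\frac{|u(x)-u(y)|^2}{|x-y|^{1+2\alpha}}\,d\mu(x)\,d\mu(y)$, where the integrand is taken to be $0$ on the diagonal $x=y$. *)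

theory Defs
  imports "HOL-Analysis.Analysis"
begin

definition TT :: "nat \<Rightarrow> real set" where
  "TT N = {0..1} \<union> real ` {2..N+1}"

definition \<mu> :: "nat \<Rightarrow> real measure" where
  "\<mu> N = measure_of (TT N) (sets (restrict_space borel (TT N)))
     (\<lambda>A. emeasure lborel (A \<inter> {0..1}) + (\<Sum>k=2..N+1. indicator A (real k)))"

lemma TT_borel [measurable]: "TT N \<in> sets borel"
  unfolding TT_def by (intro sets.Un borel_closed closed_atLeastAtMost finite_imp_closed finite_imageI) simp

lemma space_\<mu>: "space (\<mu> N) = TT N"
  using sets.space_closed[of "restrict_space borel (TT N)"]
  by (simp add: \<mu>_def space_measure_of space_restrict_space)

lemma sets_\<mu>: "sets (\<mu> N) = sets (restrict_space borel (TT N))"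
  using sets.sigma_sets_eq[of "restrict_space borel (TT N)"]
        sets.space_closed[of "restrict_space borel (TT N)"]
  by (simp add: \<mu>_def sets_measure_of space_restrict_space)

text \<open>The set function in the definition is countably additive, so it is not discarded by
  \<^const>\<open>measure_of\<close>.\<close>

lemma emeasure_\<mu>:
  assumes "A \<in> sets (\<mu> N)"
  shows "emeasure (\<mu> N) A =
    emeasure lborel (A \<inter> {0..1}) + (\<Sum>k=2..N+1. indicator A (real k))"
proof (rule emeasure_measure_of[OF \<mu>_def])
  show "sets (restrict_space borel (TT N)) \<subseteq> Pow (TT N)"
    using sets.space_closed[of "restrict_space borel (TT N)"] by (simp add: space_restrict_space)
  show "A \<in> sets (\<mu> N)" by fact
  show "positive (sets (\<mu> N))
      (\<lambda>A. emeasure lborel (A \<inter> {0..1}) + (\<Sum>k=2..N+1. indicator A (real k)))"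
    by (simp add: positive_def)
  show "countably_additive (sets (\<mu> N))
      (\<lambda>A. emeasure lborel (A \<inter> {0..1}) + (\<Sum>k=2..N+1. indicator A (real k)))"
  proof (rule countably_additiveI)
    fix A :: "nat \<Rightarrow> real set"
    assume A: "range A \<subseteq> sets (\<mu> N)" "disjoint_family A"
    have b: "A i \<in> sets borel" for i
    proof -
      have "A i \<in> sets (restrict_space borel (TT N))"
        using A(1) by (auto simp: sets_\<mu>)
      then show ?thesis by (simp add: sets_restrict_space_iff)
    qed
    have 1: "(\<Sum>i. emeasure lborel (A i \<inter> {0..1})) = emeasure lborel (\<Union>i. A i \<inter> {0..1})"
      using A(2) b by (intro suminf_emeasure) (auto simp: disjoint_family_on_def)
    have 2: "(\<Sum>i. \<Sum>k=2..N+1. indicator (A i) (real k)) =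
        (\<Sum>k=2..N+1. \<Sum>i. indicator (A i) (real k) :: ennreal)"
      by (rule suminf_sum) auto
    have 3: "(\<Sum>i. indicator (A i) x) = (indicator (\<Union>i. A i) x :: ennreal)" for x
      using A(2) by (rule suminf_indicator)
    show "(\<Sum>i. emeasure lborel (A i \<inter> {0..1}) + (\<Sum>k=2..N+1. indicator (A i) (real k))) =
        emeasure lborel ((\<Union>i. A i) \<inter> {0..1}) + (\<Sum>k=2..N+1. indicator (\<Union>i. A i) (real k))"
      by (subst suminf_add[symmetric]) (auto simp only: 1 2 3 UN_simps summableI)
  qed
qed

abbreviation unit_lborel :: "real measure" where
  "unit_lborel \<equiv> restrict_space lborel {0..1}"

definition l2_norm :: "'a measure \<Rightarrow> ('a \<Rightarrow> real) \<Rightarrow> real" where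
  "l2_norm M f = sqrt (\<integral>x. (f x)\<^sup>2 \<partial>M)"

definition gagliardo_kernel :: "real \<Rightarrow> (real \<Rightarrow> real) \<Rightarrow> real \<Rightarrow> real \<Rightarrow> real" where
  "gagliardo_kernel \<alpha> u x y =
     (if x = y then 0 else \<bar>u x - u y\<bar>\<^sup>2 / \<bar>x - y\<bar> powr (1 + 2 * \<alpha>))"

definition gagliardo_sq :: "real \<Rightarrow> (real \<Rightarrow> real) \<Rightarrow> ennreal" where
  "gagliardo_sq \<alpha> v =
     (\<integral>\<^sup>+y. (\<integral>\<^sup>+x. ennreal (gagliardo_kernel \<alpha> v x y) \<partial>unit_lborel) \<partial>unit_lborel)"

text \<open>The endpoints of \<open>{0..1}\<close> are null, so this is the space over the open interval.\<close>

definition frac_sobolev :: "real \<Rightarrow> (real \<Rightarrow> real) set" where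
  "frac_sobolev \<alpha> = {v \<in> borel_measurable unit_lborel.
     integrable unit_lborel (\<lambda>x. (v x)\<^sup>2) \<and> gagliardo_sq \<alpha> v < \<infinity>}"

text \<open>A function on \<^term>\<open>TT N\<close> is represented by a function on all reals whose values off
  \<^term>\<open>TT N\<close> are irrelevant: its components are \<^term>\<open>u\<close> on \<open>{0..1}\<close> and
  \<open>u (real k)\<close> for \<open>k \<in> {2..N+1}\<close>. Elements are representatives of \<open>\<mu> N\<close>-a.e. classes;
  the identification is made in \<open>norm_mod_ae\<close> below.\<close>

definition hybrid_space :: "nat \<Rightarrow> real \<Rightarrow> (real \<Rightarrow> real) set" where
  "hybrid_space N \<alpha> = {u \<in> borel_measurable (\<mu> N). u \<in> frac_sobolev \<alpha>}"

definition energy :: "nat \<Rightarrow> real \<Rightarrow> (real \<Rightarrow> real) \<Rightarrow> ennreal" where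
  "energy N \<alpha> u = (\<integral>\<^sup>+(x, y). ennreal (gagliardo_kernel \<alpha> u x y) \<partial>(\<mu> N \<Otimes>\<^sub>M \<mu> N))"

text \<open>\<^const>\<open>enn2real\<close> sends \<open>\<infinity>\<close> to 0; hence the norms below are meaningful only where
  \<open>gagliardo_sq\<close> resp. \<open>energy\<close> is finite.\<close>

definition energy_norm :: "nat \<Rightarrow> real \<Rightarrow> (real \<Rightarrow> real) \<Rightarrow> real" where
  "energy_norm N \<alpha> u = sqrt ((l2_norm (\<mu> N) u)\<^sup>2 + enn2real (energy N \<alpha> u))"

definition unit_mean :: "(real \<Rightarrow> real) \<Rightarrow> real" where
  "unit_mean v = (\<integral>x. v x \<partial>unit_lborel)"

definition star_norm :: "nat \<Rightarrow> real \<Rightarrow> (real \<Rightarrow> real) \<Rightarrow> real" where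
  "star_norm N \<alpha> u = sqrt ((l2_norm (\<mu> N) u)\<^sup>2 + enn2real (gagliardo_sq \<alpha> u)
     + (l2_norm unit_lborel (\<lambda>x. u x - unit_mean u))\<^sup>2
     + (\<Sum>k=2..N+1. \<bar>u (real k) - unit_mean u\<bar>\<^sup>2))"

text \<open>\<open>V\<close> is a vector space of measurable functions, saturated under a.e. equality, and \<open>n\<close>
  is constant on a.e. classes and induces a norm on the quotient of \<open>V\<close> by a.e. equality.\<close>

definition norm_mod_ae ::
    "'a measure \<Rightarrow> ('a \<Rightarrow> real) set \<Rightarrow> (('a \<Rightarrow> real) \<Rightarrow> real) \<Rightarrow> bool" where
  "norm_mod_ae M V n \<longleftrightarrow>
     V \<subseteq> borel_measurable M \<and>
     (\<lambda>x. 0) \<in> V \<and>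
     (\<forall>u\<in>V. \<forall>w\<in>V. (\<lambda>x. u x + w x) \<in> V) \<and>
     (\<forall>c. \<forall>u\<in>V. (\<lambda>x. c * u x) \<in> V) \<and>
     (\<forall>u\<in>V. \<forall>w\<in>borel_measurable M. (AE x in M. w x = u x) \<longrightarrow> w \<in> V \<and> n w = n u) \<and>
     (\<forall>u\<in>V. 0 \<le> n u) \<and>
     (\<forall>u\<in>V. n u = 0 \<longleftrightarrow> (AE x in M. u x = 0)) \<and>
     (\<forall>c. \<forall>u\<in>V. n (\<lambda>x. c * u x) = \<bar>c\<bar> * n u) \<and>
     (\<forall>u\<in>V. \<forall>w\<in>V. n (\<lambda>x. u x + w x) \<le> n u + n w)"

definition equivalent_on :: "'b set \<Rightarrow> ('b \<Rightarrow> real) \<Rightarrow> ('b \<Rightarrow> real) \<Rightarrow> bool" where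
  "equivalent_on V m n \<longleftrightarrow>
     (\<exists>c>0. \<exists>C>0. \<forall>u\<in>V. c * m u \<le> n u \<and> n u \<le> C * m u)"

end

theory Submission
  imports Defs
begin

text \<open>Each part of either norm is the \<open>L\<^sup>2\<close> norm of a linear expression in \<open>u\<close>: the energies are
  squared \<open>L\<^sup>2\<close> norms of the difference quotient on a product space, so that both norms are Euclidean
  combinations of seminorms. For the equivalence, write \<open>m\<close> for the mean of \<open>u\<close> over \<open>[0,1]\<close>. The
  energy is the Gagliardo energy on \<open>[0,1]\<close> plus twice the cross terms between \<open>[0,1]\<close> and the points
  \<open>k\<close> plus a finite sum over pairs of points. In the cross terms the distances lie between \<open>1\<close> and
  \<open>N + 1\<close>, so up to constants they are the integrals of \<open>(u x - u k)\<^sup>2\<close>, which split orthogonally into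
  the variance of \<open>u\<close> on \<open>[0,1]\<close> and \<open>(u k - m)\<^sup>2\<close>. The pairs of points are dominated by the same
  quantities, through \<open>(u j - u k)\<^sup>2 \<le> 2 (u j - m)\<^sup>2 + 2 (u k - m)\<^sup>2\<close>.\<close>

section \<open>Seminorms compatible with a.e. equality\<close>

text \<open>Definiteness and the closure properties of \<open>V\<close> are left out, so that each
  summand of a squared norm can be treated separately. They are added once, when a seminorm is
  turned into a norm.\<close>

definition seminorm_mod_ae ::
    "'a measure \<Rightarrow> ('a \<Rightarrow> real) set \<Rightarrow> (('a \<Rightarrow> real) \<Rightarrow> real) \<Rightarrow> bool" where
  "seminorm_mod_ae M V p \<longleftrightarrow>
     (\<forall>u. 0 \<le> p u) \<and>
     (\<forall>u\<in>V. \<forall>w\<in>V. (AE x in M. w x = u x) \<longrightarrow> p w = p u) \<and>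
     (\<forall>c. \<forall>u\<in>V. p (\<lambda>x. c * u x) = \<bar>c\<bar> * p u) \<and>
     (\<forall>u\<in>V. \<forall>w\<in>V. p (\<lambda>x. u x + w x) \<le> p u + p w)"

lemma
  assumes "seminorm_mod_ae M V p"
  shows seminorm_mod_ae_nonneg: "0 \<le> p u"
    and seminorm_mod_ae_cong: "u \<in> V \<Longrightarrow> w \<in> V \<Longrightarrow> AE x in M. w x = u x \<Longrightarrow> p w = p u"
    and seminorm_mod_ae_cmult: "u \<in> V \<Longrightarrow> p (\<lambda>x. c * u x) = \<bar>c\<bar> * p u"
    and seminorm_mod_ae_triangle: "u \<in> V \<Longrightarrow> w \<in> V \<Longrightarrow> p (\<lambda>x. u x + w x) \<le> p u + p w"
  using assms unfolding seminorm_mod_ae_def by blast+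

text \<open>The Euclidean norm on the plane is monotone on nonnegative vectors and satisfies the
  triangle inequality; both facts are applied to the vectors \<open>(p u, q u)\<close> and
  \<open>(p w, q w)\<close>.\<close>

lemma seminorm_mod_ae_sqrt:
  assumes p: "seminorm_mod_ae M V p" and q: "seminorm_mod_ae M V q"
  shows "seminorm_mod_ae M V (\<lambda>u. sqrt ((p u)\<^sup>2 + (q u)\<^sup>2))"
  unfolding seminorm_mod_ae_def
proof (intro conjI ballI allI impI)
  fix u
  show "0 \<le> sqrt ((p u)\<^sup>2 + (q u)\<^sup>2)" by simp
next
  fix u w assume uw: "u \<in> V" "w \<in> V"
  show "sqrt ((p w)\<^sup>2 + (q w)\<^sup>2) = sqrt ((p u)\<^sup>2 + (q u)\<^sup>2)" if "AE x in M. w x = u x"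
    by (simp only: seminorm_mod_ae_cong[OF p uw that] seminorm_mod_ae_cong[OF q uw that])
next
  fix u w assume uw: "u \<in> V" "w \<in> V"
  have "sqrt ((p (\<lambda>x. u x + w x))\<^sup>2 + (q (\<lambda>x. u x + w x))\<^sup>2)
      \<le> sqrt ((p u + p w)\<^sup>2 + (q u + q w)\<^sup>2)"
    by (intro real_sqrt_le_mono add_mono power_mono seminorm_mod_ae_triangle[OF p uw]
      seminorm_mod_ae_triangle[OF q uw] seminorm_mod_ae_nonneg[OF p] seminorm_mod_ae_nonneg[OF q])
  also have "\<dots> \<le> sqrt ((p u)\<^sup>2 + (q u)\<^sup>2) + sqrt ((p w)\<^sup>2 + (q w)\<^sup>2)"
    by (rule real_sqrt_sum_squares_triangle_ineq)
  finally show "sqrt ((p (\<lambda>x. u x + w x))\<^sup>2 + (q (\<lambda>x. u x + w x))\<^sup>2)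
      \<le> sqrt ((p u)\<^sup>2 + (q u)\<^sup>2) + sqrt ((p w)\<^sup>2 + (q w)\<^sup>2)" .
next
  fix c u assume u: "u \<in> V"
  have "sqrt ((p (\<lambda>x. c * u x))\<^sup>2 + (q (\<lambda>x. c * u x))\<^sup>2)
      = sqrt (c\<^sup>2 * ((p u)\<^sup>2 + (q u)\<^sup>2))"
    unfolding seminorm_mod_ae_cmult[OF p u] seminorm_mod_ae_cmult[OF q u]
    by (simp add: power_mult_distrib distrib_left)
  then show "sqrt ((p (\<lambda>x. c * u x))\<^sup>2 + (q (\<lambda>x. c * u x))\<^sup>2)
      = \<bar>c\<bar> * sqrt ((p u)\<^sup>2 + (q u)\<^sup>2)"
    by (simp add: real_sqrt_mult)
qed

text \<open>The same argument for finitely many seminorms at once; it serves the sum over the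
  isolated points.\<close>

lemma seminorm_mod_ae_L2_set:
  assumes p: "\<And>i. i \<in> A \<Longrightarrow> seminorm_mod_ae M V (p i)"
  shows "seminorm_mod_ae M V (\<lambda>u. L2_set (\<lambda>i. p i u) A)"
  unfolding seminorm_mod_ae_def
proof (intro conjI ballI allI impI)
  fix u
  show "0 \<le> L2_set (\<lambda>i. p i u) A" by (rule L2_set_nonneg)
next
  fix u w assume uw: "u \<in> V" "w \<in> V"
  show "L2_set (\<lambda>i. p i w) A = L2_set (\<lambda>i. p i u) A" if "AE x in M. w x = u x"
    by (rule L2_set_cong[OF refl]) (rule seminorm_mod_ae_cong[OF p uw that])
next
  fix u w assume uw: "u \<in> V" "w \<in> V"
  have "L2_set (\<lambda>i. p i (\<lambda>x. u x + w x)) A \<le> L2_set (\<lambda>i. p i u + p i w) A"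
    by (intro L2_set_mono seminorm_mod_ae_triangle[OF p uw] seminorm_mod_ae_nonneg[OF p])
  also have "\<dots> \<le> L2_set (\<lambda>i. p i u) A + L2_set (\<lambda>i. p i w) A"
    by (rule L2_set_triangle_ineq)
  finally show "L2_set (\<lambda>i. p i (\<lambda>x. u x + w x)) A
      \<le> L2_set (\<lambda>i. p i u) A + L2_set (\<lambda>i. p i w) A" .
next
  fix c u assume u: "u \<in> V"
  have "L2_set (\<lambda>i. p i (\<lambda>x. c * u x)) A = L2_set (\<lambda>i. \<bar>c\<bar> * p i u) A"
    by (rule L2_set_cong[OF refl]) (rule seminorm_mod_ae_cmult[OF p u])
  then show "L2_set (\<lambda>i. p i (\<lambda>x. c * u x)) A = \<bar>c\<bar> * L2_set (\<lambda>i. p i u) A"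
    by (simp add: L2_set_right_distrib)
qed

section \<open>Minkowski's inequality for square integrals\<close>

text \<open>The two sides differ by a perfect square over \<open>a * b\<close>. For
  \<open>x = a\<close> and \<open>y = b\<close> the bound is sharp, which is why it yields the exact
  constant in Minkowski's inequality; \<open>a = b = 1\<close> gives the familiar factor 2.\<close>

lemma square_sum_le_weighted:
  fixes x y a b :: real
  assumes "0 < a" "0 < b"
  shows "(x + y)\<^sup>2 \<le> (1 + b / a) * x\<^sup>2 + (1 + a / b) * y\<^sup>2"
proof -
  have "(1 + b / a) * x\<^sup>2 + (1 + a / b) * y\<^sup>2 - (x + y)\<^sup>2 = (b * x - a * y)\<^sup>2 / (a * b)"
    using assms by (simp add: field_simps power2_eq_square)
  moreover have "\<dots> \<ge> 0" using assms by simp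
  ultimately show ?thesis by linarith
qed

text \<open>Minkowski's inequality without Hoelder's: apply the weighted bound above, with the weights
  \<open>a\<close> and \<open>b\<close> decreasing to the two \<open>L\<^sup>2\<close> norms.\<close>

lemma nn_integral_square_add_le:
  fixes f g :: "'a \<Rightarrow> real"
  assumes [measurable]: "f \<in> borel_measurable M" "g \<in> borel_measurable M" and ab: "0 < a" "0 < b"
    and "(\<integral>\<^sup>+x. ennreal ((f x)\<^sup>2) \<partial>M) \<le> ennreal (a\<^sup>2)"
    and "(\<integral>\<^sup>+x. ennreal ((g x)\<^sup>2) \<partial>M) \<le> ennreal (b\<^sup>2)"
  shows "(\<integral>\<^sup>+x. ennreal ((f x + g x)\<^sup>2) \<partial>M) \<le> ennreal ((a + b)\<^sup>2)"
proof -
  have "(\<integral>\<^sup>+x. ennreal ((f x + g x)\<^sup>2) \<partial>M)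
      \<le> (\<integral>\<^sup>+x. ennreal (1 + b / a) * ennreal ((f x)\<^sup>2) + ennreal (1 + a / b) * ennreal ((g x)\<^sup>2) \<partial>M)"
    using ab
    by (intro nn_integral_mono)
      (auto simp flip: ennreal_mult ennreal_plus intro!: ennreal_leI square_sum_le_weighted)
  also have "\<dots> = ennreal (1 + b / a) * (\<integral>\<^sup>+x. ennreal ((f x)\<^sup>2) \<partial>M)
      + ennreal (1 + a / b) * (\<integral>\<^sup>+x. ennreal ((g x)\<^sup>2) \<partial>M)"
    by (simp add: nn_integral_add nn_integral_cmult)
  also have "\<dots> \<le> ennreal (1 + b / a) * ennreal (a\<^sup>2) + ennreal (1 + a / b) * ennreal (b\<^sup>2)"
    using assms by (intro add_mono mult_left_mono) auto
  also have "\<dots> = ennreal ((1 + b / a) * a\<^sup>2 + (1 + a / b) * b\<^sup>2)"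
    using ab by (simp flip: ennreal_mult ennreal_plus)
  also have "(1 + b / a) * a\<^sup>2 + (1 + a / b) * b\<^sup>2 = (a + b)\<^sup>2"
    using ab by (simp add: field_simps power2_eq_square)
  finally show ?thesis .
qed

text \<open>The preceding bound needs positive radii, while an L^2 norm may vanish. Both norms are
  therefore enlarged by \<open>e\<close>; any fixed \<open>e\<close> gives finiteness, and
  arbitrarily small \<open>e\<close> gives the triangle inequality.\<close>

lemma
  fixes f g :: "'a \<Rightarrow> real"
  assumes "f \<in> borel_measurable M" "g \<in> borel_measurable M"
    and F: "(\<integral>\<^sup>+x. ennreal ((f x)\<^sup>2) \<partial>M) < \<infinity>" and G: "(\<integral>\<^sup>+x. ennreal ((g x)\<^sup>2) \<partial>M) < \<infinity>"
  shows nn_integral_square_add_finite: "(\<integral>\<^sup>+x. ennreal ((f x + g x)\<^sup>2) \<partial>M) < \<infinity>"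
    and sqrt_nn_integral_square_triangle: "sqrt (enn2real (\<integral>\<^sup>+x. ennreal ((f x + g x)\<^sup>2) \<partial>M))
      \<le> sqrt (enn2real (\<integral>\<^sup>+x. ennreal ((f x)\<^sup>2) \<partial>M)) + sqrt (enn2real (\<integral>\<^sup>+x. ennreal ((g x)\<^sup>2) \<partial>M))"
proof -
  let ?F = "\<integral>\<^sup>+x. ennreal ((f x)\<^sup>2) \<partial>M" and ?G = "\<integral>\<^sup>+x. ennreal ((g x)\<^sup>2) \<partial>M"
    and ?H = "\<integral>\<^sup>+x. ennreal ((f x + g x)\<^sup>2) \<partial>M"
  have bound: "I \<le> ennreal ((sqrt (enn2real I) + e)\<^sup>2)" if "I < \<infinity>" "0 < e" for I e
  proof -
    have "enn2real I = (sqrt (enn2real I))\<^sup>2" by simp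
    also have "\<dots> \<le> (sqrt (enn2real I) + e)\<^sup>2"
      using that by (intro power_mono) auto
    finally show ?thesis
      using that by (metis ennreal_enn2real ennreal_leI infinity_ennreal_def)
  qed
  have H: "?H \<le> ennreal (((sqrt (enn2real ?F) + e) + (sqrt (enn2real ?G) + e))\<^sup>2)" if "0 < e" for e
  proof (rule nn_integral_square_add_le)
    show "0 < sqrt (enn2real ?F) + e" "0 < sqrt (enn2real ?G) + e"
      using that by (simp_all add: add_nonneg_pos)
  qed (use assms(1,2) bound[OF F that] bound[OF G that] in simp_all)
  from H[of 1] show "?H < \<infinity>"
    by (simp add: le_less_trans[OF _ ennreal_less_top])
  show "sqrt (enn2real ?H) \<le> sqrt (enn2real ?F) + sqrt (enn2real ?G)"
  proof (rule field_le_epsilon)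
    fix e :: real assume "0 < e"
    then have "?H \<le> ennreal ((sqrt (enn2real ?F) + sqrt (enn2real ?G) + e)\<^sup>2)"
      using H[of "e / 2"] by (simp add: algebra_simps)
    then have "enn2real ?H \<le> (sqrt (enn2real ?F) + sqrt (enn2real ?G) + e)\<^sup>2"
      by (simp add: enn2real_leI)
    then show "sqrt (enn2real ?H) \<le> sqrt (enn2real ?F) + sqrt (enn2real ?G) + e"
      using \<open>0 < e\<close> by (intro real_le_lsqrt) auto
  qed
qed

section \<open>Difference quotients and energies over a general measure\<close>

text \<open>A signed square root of the Gagliardo kernel, hence the halved exponent. Unlike the
  kernel it is linear in \<open>u\<close>, so Minkowski's inequality can be applied to it.\<close>

definition gagliardo_quotient :: "real \<Rightarrow> (real \<Rightarrow> real) \<Rightarrow> real \<Rightarrow> real \<Rightarrow> real" where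
  "gagliardo_quotient \<alpha> u x y =
     (if x = y then 0 else (u x - u y) / \<bar>x - y\<bar> powr ((1 + 2 * \<alpha>) / 2))"

lemma gagliardo_kernel_eq: "gagliardo_kernel \<alpha> u x y = (gagliardo_quotient \<alpha> u x y)\<^sup>2"
proof (cases "x = y")
  case False
  have "(\<bar>x - y\<bar> powr ((1 + 2 * \<alpha>) / 2))\<^sup>2 = \<bar>x - y\<bar> powr (1 + 2 * \<alpha>)"
    unfolding power2_eq_square powr_add[symmetric] by (simp only: field_sum_of_halves)
  with False show ?thesis
    by (simp add: gagliardo_kernel_def gagliardo_quotient_def power_divide)
qed (simp add: gagliardo_kernel_def gagliardo_quotient_def)

lemma gagliardo_quotient_add:
  "gagliardo_quotient \<alpha> (\<lambda>x. u x + w x) x y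
    = gagliardo_quotient \<alpha> u x y + gagliardo_quotient \<alpha> w x y"
  by (simp add: gagliardo_quotient_def add_divide_distrib diff_divide_distrib)

lemma gagliardo_quotient_cmult:
  "gagliardo_quotient \<alpha> (\<lambda>x. c * u x) x y = c * gagliardo_quotient \<alpha> u x y"
  by (simp add: gagliardo_quotient_def right_diff_distrib)

lemma gagliardo_kernel_nonneg: "0 \<le> gagliardo_kernel \<alpha> u x y"
  by (simp add: gagliardo_kernel_eq)

lemma gagliardo_kernel_commute: "gagliardo_kernel \<alpha> u x y = gagliardo_kernel \<alpha> u y x"
  by (simp add: gagliardo_kernel_def abs_minus_commute)

lemma measurable_gagliardo_quotient:
  assumes [measurable]: "u \<in> borel_measurable M" and [measurable]: "(\<lambda>x. x) \<in> borel_measurable M"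
  shows "(\<lambda>(x, y). gagliardo_quotient \<alpha> u x y) \<in> borel_measurable (M \<Otimes>\<^sub>M M)"
  unfolding gagliardo_quotient_def by measurable

text \<open>One notion for both energies: \<open>M = \<mu> N\<close> gives the hybrid energy, and
  \<open>M = unit_lborel\<close> the Gagliardo seminorm squared. The visible square over the product
  measure matches the form of the Minkowski lemmas.\<close>

definition energy_on :: "real measure \<Rightarrow> real \<Rightarrow> (real \<Rightarrow> real) \<Rightarrow> ennreal" where
  "energy_on M \<alpha> u = (\<integral>\<^sup>+z. ennreal ((case z of (x, y) \<Rightarrow> gagliardo_quotient \<alpha> u x y)\<^sup>2) \<partial>(M \<Otimes>\<^sub>M M))"

lemma energy_eq: "energy N \<alpha> u = energy_on (\<mu> N) \<alpha> u"
  by (simp add: energy_def energy_on_def gagliardo_kernel_eq case_prod_beta')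

text \<open>Tonelli's theorem, with the order of integration used in
  \<open>gagliardo_sq\<close>.\<close>

lemma energy_on_iterated:
  assumes "sigma_finite_measure M" "u \<in> borel_measurable M" "(\<lambda>x. x) \<in> borel_measurable M"
  shows "energy_on M \<alpha> u = (\<integral>\<^sup>+y. (\<integral>\<^sup>+x. ennreal (gagliardo_kernel \<alpha> u x y) \<partial>M) \<partial>M)"
proof -
  interpret sigma_finite_measure M by fact
  interpret pair_sigma_finite M M ..
  note [measurable] = measurable_gagliardo_quotient[OF assms(2,3)]
  show ?thesis
    unfolding energy_on_def
    by (subst nn_integral_snd[symmetric]) (simp_all add: gagliardo_kernel_eq)
qed

text \<open>In the iterated form the a.e. equality is used once for the outer and once for the inner
  variable, so no null sets of the product have to be handled.\<close>

lemma energy_on_cong_AE: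
  assumes M: "sigma_finite_measure M" "(\<lambda>x. x) \<in> borel_measurable M"
    and uw: "u \<in> borel_measurable M" "w \<in> borel_measurable M" and ae: "AE x in M. w x = u x"
  shows "energy_on M \<alpha> w = energy_on M \<alpha> u"
  unfolding energy_on_iterated[OF M(1) uw(1) M(2)] energy_on_iterated[OF M(1) uw(2) M(2)]
proof (rule nn_integral_cong_AE)
  show "AE y in M. (\<integral>\<^sup>+x. ennreal (gagliardo_kernel \<alpha> w x y) \<partial>M)
      = (\<integral>\<^sup>+x. ennreal (gagliardo_kernel \<alpha> u x y) \<partial>M)"
    using ae
  proof eventually_elim
    case (elim y)
    show ?case
      by (rule nn_integral_cong_AE)
        (use ae in eventually_elim, use elim in \<open>simp add: gagliardo_kernel_def\<close>)
  qed
qed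

lemma energy_on_cmult:
  assumes "u \<in> borel_measurable M" "(\<lambda>x. x) \<in> borel_measurable M"
  shows "energy_on M \<alpha> (\<lambda>x. c * u x) = ennreal (c\<^sup>2) * energy_on M \<alpha> u"
proof -
  note [measurable] = measurable_gagliardo_quotient[OF assms]
  show ?thesis
    unfolding energy_on_def
    by (subst nn_integral_cmult[symmetric])
      (auto simp: gagliardo_quotient_cmult power_mult_distrib ennreal_mult case_prod_beta')
qed

lemma
  assumes "u \<in> borel_measurable M" "w \<in> borel_measurable M" "(\<lambda>x. x) \<in> borel_measurable M"
    and "energy_on M \<alpha> u < \<infinity>" "energy_on M \<alpha> w < \<infinity>"
  shows energy_on_add_finite: "energy_on M \<alpha> (\<lambda>x. u x + w x) < \<infinity>"
    and sqrt_energy_on_triangle: "sqrt (enn2real (energy_on M \<alpha> (\<lambda>x. u x + w x)))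
      \<le> sqrt (enn2real (energy_on M \<alpha> u)) + sqrt (enn2real (energy_on M \<alpha> w))"
proof -
  have eq: "energy_on M \<alpha> (\<lambda>x. u x + w x) = (\<integral>\<^sup>+z. ennreal (((case z of (x, y) \<Rightarrow> gagliardo_quotient \<alpha> u x y)
      + (case z of (x, y) \<Rightarrow> gagliardo_quotient \<alpha> w x y))\<^sup>2) \<partial>(M \<Otimes>\<^sub>M M))"
    by (simp add: energy_on_def gagliardo_quotient_add case_prod_beta')
  note m = measurable_gagliardo_quotient[OF assms(1,3)] measurable_gagliardo_quotient[OF assms(2,3)]
  show "energy_on M \<alpha> (\<lambda>x. u x + w x) < \<infinity>"
    unfolding eq using assms(4,5) unfolding energy_on_def
    by (intro nn_integral_square_add_finite m)
  show "sqrt (enn2real (energy_on M \<alpha> (\<lambda>x. u x + w x)))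
      \<le> sqrt (enn2real (energy_on M \<alpha> u)) + sqrt (enn2real (energy_on M \<alpha> w))"
    unfolding eq using assms(4,5) unfolding energy_on_def
    by (intro sqrt_nn_integral_square_triangle m)
qed

section \<open>Real-valued L^2 norms\<close>

text \<open>If the square is not integrable, both sides are 0: the Bochner integral and
  \<open>enn2real\<close> have matching default values.\<close>

lemma l2_norm_eq:
  assumes "f \<in> borel_measurable M"
  shows "l2_norm M f = sqrt (enn2real (\<integral>\<^sup>+x. ennreal ((f x)\<^sup>2) \<partial>M))"
  unfolding l2_norm_def using assms by (subst integral_eq_nn_integral) auto

lemma l2_norm_nonneg: "0 \<le> l2_norm M f"
  by (simp add: l2_norm_def)

lemma l2_norm_cmult: "l2_norm M (\<lambda>x. c * f x) = \<bar>c\<bar> * l2_norm M f"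
  by (simp add: l2_norm_def power_mult_distrib real_sqrt_mult)

lemma l2_norm_cong_AE:
  assumes "f \<in> borel_measurable M" "g \<in> borel_measurable M" "AE x in M. f x = g x"
  shows "l2_norm M f = l2_norm M g"
  unfolding l2_norm_def
  by (intro arg_cong[where f = sqrt] integral_cong_AE) (use assms in auto)

lemma integrable_square_iff:
  assumes "f \<in> borel_measurable M"
  shows "integrable M (\<lambda>x. (f x)\<^sup>2) \<longleftrightarrow> (\<integral>\<^sup>+x. ennreal ((f x)\<^sup>2) \<partial>M) < \<infinity>"
  using assms by (subst integrable_iff_bounded) auto

lemma
  assumes "f \<in> borel_measurable M" "g \<in> borel_measurable M"
    "integrable M (\<lambda>x. (f x)\<^sup>2)" "integrable M (\<lambda>x. (g x)\<^sup>2)"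
  shows integrable_square_add: "integrable M (\<lambda>x. (f x + g x)\<^sup>2)"
    and l2_norm_triangle: "l2_norm M (\<lambda>x. f x + g x) \<le> l2_norm M f + l2_norm M g"
  using assms nn_integral_square_add_finite[of f M g] sqrt_nn_integral_square_triangle[of f M g]
  by (simp_all add: integrable_square_iff l2_norm_eq)

section \<open>The measure \<mu>: its atoms and its restriction to the unit interval\<close>

lemma finite_measure_unit_lborel: "finite_measure unit_lborel"
  by (rule finite_measureI) (simp add: space_restrict_space emeasure_restrict_space)

lemma measurable_id_\<mu>: "(\<lambda>x. x) \<in> borel_measurable (\<mu> N)"
  using measurable_restrict_space1[of "\<lambda>x. x" borel borel "TT N"] measurable_cong_sets[OF sets_\<mu> refl]
  by auto

lemma measurable_id_unit: "(\<lambda>x. x) \<in> borel_measurable unit_lborel"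
  by (rule measurable_restrict_space1) simp

lemma unit_interval_sets_\<mu>: "{0..1} \<in> sets (\<mu> N)"
proof -
  have "{0..1} \<subseteq> TT N" by (simp add: TT_def)
  then show ?thesis by (simp add: sets_\<mu> sets_restrict_space_iff)
qed

lemma point_sets_\<mu>: "x \<in> TT N \<Longrightarrow> {x} \<in> sets (\<mu> N)"
  by (auto simp: sets_\<mu> sets_restrict_space_iff)

text \<open>This identity carries measurability and a.e. statements from \<open>\<mu> N\<close> over
  to the unit interval.\<close>

lemma restrict_space_\<mu>: "restrict_space (\<mu> N) {0..1} = unit_lborel"
proof (rule measure_eqI)
  have 1: "TT N \<inter> {0..1} = {0..1}" by (auto simp: TT_def)
  have "sets (restrict_space (\<mu> N) {0..1}) = sets (restrict_space (restrict_space borel (TT N)) {0..1})"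
    by (rule sets_restrict_space_cong[OF sets_\<mu>])
  also have "\<dots> = sets (restrict_space borel (TT N \<inter> {0..1}))"
    by (rule sets_restrict_restrict_space)
  also have "\<dots> = sets unit_lborel"
    unfolding 1 by (rule sets_restrict_space_cong) simp
  finally show eq: "sets (restrict_space (\<mu> N) {0..1}) = sets unit_lborel" .
  fix A assume A: "A \<in> sets (restrict_space (\<mu> N) {0..1})"
  then have A': "A \<in> sets (\<mu> N)" "A \<subseteq> {0..1}"
    using sets_restrict_space_iff[of "{0..1}" "\<mu> N" A] unit_interval_sets_\<mu> sets.sets_into_space[OF unit_interval_sets_\<mu>]
    by (auto simp: Int_absorb1)
  \<comment> \<open>The atoms start at 2, so a subset of \<open>{0..1}\<close> contains none of
    them.\<close>
  have "(\<Sum>k=2..N+1. indicator A (real k)) = (0 :: ennreal)"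
    using A'(2) by (intro sum.neutral) (auto simp: indicator_def)
  with A' show "emeasure (restrict_space (\<mu> N) {0..1}) A = emeasure unit_lborel A"
    using unit_interval_sets_\<mu> sets.sets_into_space[OF unit_interval_sets_\<mu>]
    by (simp add: emeasure_restrict_space emeasure_\<mu> Int_absorb1 Int_absorb2)
qed

lemma emeasure_\<mu>_point:
  assumes "k \<in> {2..N+1}"
  shows "emeasure (\<mu> N) {real k} = 1"
proof -
  have "(\<Sum>j=2..N+1. indicator {real k} (real j)) = (\<Sum>j=2..N+1. if j = k then 1 else 0 :: ennreal)"
    by (intro sum.cong) (auto simp: indicator_def)
  with assms have s: "(\<Sum>j=2..N+1. indicator {real k} (real j)) = (1 :: ennreal)" by simp
  have "{real k} \<in> sets (\<mu> N)" using assms by (intro point_sets_\<mu>) (auto simp: TT_def)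
  moreover have "{real k} \<inter> {0..1} = {}" using assms by auto
  ultimately show ?thesis unfolding emeasure_\<mu>[OF \<open>{real k} \<in> sets (\<mu> N)\<close>] s by simp
qed

lemma finite_measure_\<mu>: "finite_measure (\<mu> N)"
proof (rule finite_measureI)
  have "emeasure (\<mu> N) (space (\<mu> N)) = emeasure lborel (space (\<mu> N) \<inter> {0..1})
      + (\<Sum>k=2..N+1. indicator (space (\<mu> N)) (real k))"
    by (rule emeasure_\<mu>) simp
  also have "\<dots> \<le> emeasure lborel {0..1::real} + (\<Sum>k=2..N+1. 1)"
    by (intro add_mono emeasure_mono sum_mono) (auto simp: indicator_def)
  also have "\<dots> < \<infinity>" by (simp add: ennreal_add_eq_top top.not_eq_extremum[symmetric] del: sum.cl_ivl_Suc)
  finally show "emeasure (\<mu> N) (space (\<mu> N)) \<noteq> \<infinity>" by simp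
qed

text \<open>On \<open>TT N\<close> the integrand is the sum of its part on \<open>{0..1}\<close> and
  of finitely many functions, each supported at one atom of mass 1.\<close>

lemma nn_integral_\<mu>:
  assumes "f \<in> borel_measurable (\<mu> N)"
  shows "(\<integral>\<^sup>+x. f x \<partial>\<mu> N) = (\<integral>\<^sup>+x. f x \<partial>unit_lborel) + (\<Sum>k=2..N+1. f (real k))"
proof -
  have pt: "{real k} \<in> sets (\<mu> N)" if "k \<in> {2..N+1}" for k
    using that by (intro point_sets_\<mu>) (auto simp: TT_def)
  have split: "f x = f x * indicator {0..1} x + (\<Sum>k=2..N+1. f (real k) * indicator {real k} x)"
    if x: "x \<in> TT N" for x
  proof (cases "x \<in> {0..1}")
    case True
    then have "(\<Sum>k=2..N+1. f (real k) * indicator {real k} x) = 0"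
      by (intro sum.neutral) (auto simp: indicator_def)
    with True show ?thesis by simp
  next
    case False
    then obtain j where j: "j \<in> {2..N+1}" "x = real j" using x unfolding TT_def by blast
    have "(\<Sum>k=2..N+1. f (real k) * indicator {real k} x) = (\<Sum>k=2..N+1. if k = j then f x else 0)"
      using j by (intro sum.cong) (auto simp: indicator_def)
    with j(1) have "(\<Sum>k=2..N+1. f (real k) * indicator {real k} x) = f x"
      by (simp only: sum.delta finite_atLeastAtMost if_True)
    with False show ?thesis by simp
  qed
  have m: "(\<lambda>x. f (real k) * indicator {real k} x) \<in> borel_measurable (\<mu> N)" if "k \<in> {2..N+1}" for k
    by (intro borel_measurable_times_ennreal borel_measurable_const borel_measurable_indicator pt that)
  have "(\<integral>\<^sup>+x. f x \<partial>\<mu> N) = (\<integral>\<^sup>+x. f x * indicator {0..1} x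
      + (\<Sum>k=2..N+1. f (real k) * indicator {real k} x) \<partial>\<mu> N)"
    by (rule nn_integral_cong) (rule split, simp add: space_\<mu>)
  also have "\<dots> = (\<integral>\<^sup>+x. f x * indicator {0..1} x \<partial>\<mu> N)
      + (\<integral>\<^sup>+x. (\<Sum>k=2..N+1. f (real k) * indicator {real k} x) \<partial>\<mu> N)"
    by (rule nn_integral_add) (intro borel_measurable_times_ennreal borel_measurable_indicator assms
      unit_interval_sets_\<mu> borel_measurable_sum m)+
  also have "(\<integral>\<^sup>+x. f x * indicator {0..1} x \<partial>\<mu> N) = (\<integral>\<^sup>+x. f x \<partial>restrict_space (\<mu> N) {0..1})"
    using unit_interval_sets_\<mu>[of N] by (intro nn_integral_restrict_space[symmetric]) auto
  also have "(\<integral>\<^sup>+x. (\<Sum>k=2..N+1. f (real k) * indicator {real k} x) \<partial>\<mu> N)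
      = (\<Sum>k=2..N+1. \<integral>\<^sup>+x. f (real k) * indicator {real k} x \<partial>\<mu> N)"
    by (rule nn_integral_sum) (erule m)
  also have "\<dots> = (\<Sum>k=2..N+1. f (real k))"
  proof (rule sum.cong[OF refl])
    fix k assume k: "k \<in> {2..N+1}"
    show "(\<integral>\<^sup>+x. f (real k) * indicator {real k} x \<partial>\<mu> N) = f (real k)"
      unfolding nn_integral_cmult_indicator[OF pt[OF k]] emeasure_\<mu>_point[OF k] by simp
  qed
  finally show ?thesis unfolding restrict_space_\<mu> .
qed

lemma measurable_\<mu>_unit: "u \<in> borel_measurable (\<mu> N) \<Longrightarrow> u \<in> borel_measurable unit_lborel"
  by (subst restrict_space_\<mu>[of N, symmetric]) (rule measurable_restrict_space1)

lemma AE_\<mu>_unit: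
  assumes "AE x in \<mu> N. P x"
  shows "AE x in unit_lborel. P x"
  unfolding restrict_space_\<mu>[of N, symmetric]
proof (subst AE_restrict_space_iff)
  show "{0..1} \<inter> space (\<mu> N) \<in> sets (\<mu> N)"
    using unit_interval_sets_\<mu> by blast
  show "AE x in \<mu> N. x \<in> {0..1} \<longrightarrow> P x"
    using assms by eventually_elim simp
qed

text \<open>An atom has mass 1 and so lies in no null set. Hence the values
  \<open>u (real k)\<close> depend only on the a.e. class of \<open>u\<close>.\<close>

lemma AE_\<mu>_point:
  assumes ae: "AE x in \<mu> N. P x" and k: "k \<in> {2..N+1}"
  shows "P (real k)"
proof (rule ccontr)
  assume "\<not> P (real k)"
  moreover from ae obtain A where A: "{x \<in> space (\<mu> N). \<not> P x} \<subseteq> A" "emeasure (\<mu> N) A = 0"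
      "A \<in> sets (\<mu> N)"
    by (rule AE_E)
  moreover have "real k \<in> space (\<mu> N)" using k unfolding space_\<mu> TT_def by blast
  ultimately have "{real k} \<subseteq> A" by blast
  then have "emeasure (\<mu> N) {real k} \<le> emeasure (\<mu> N) A"
    using A(3) by (rule emeasure_mono)
  with A(2) emeasure_\<mu>_point[OF k] show False by simp
qed

section \<open>The hybrid space as a vector space saturated under a.e. equality\<close>

lemma gagliardo_sq_eq:
  assumes "u \<in> borel_measurable (\<mu> N)"
  shows "gagliardo_sq \<alpha> u = energy_on unit_lborel \<alpha> u"
proof -
  interpret finite_measure unit_lborel by (rule finite_measure_unit_lborel)
  show ?thesis
    unfolding gagliardo_sq_def
    by (rule energy_on_iterated[symmetric])
      (rule sigma_finite_measure_axioms measurable_\<mu>_unit[OF assms] measurable_id_unit)+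
qed

text \<open>The two integrals differ by the finite sum of the squared point values.\<close>

lemma integrable_square_\<mu>_iff:
  fixes u :: "real \<Rightarrow> real"
  assumes u: "u \<in> borel_measurable (\<mu> N)"
  shows "integrable (\<mu> N) (\<lambda>x. (u x)\<^sup>2) \<longleftrightarrow> integrable unit_lborel (\<lambda>x. (u x)\<^sup>2)"
proof -
  have "(\<lambda>x. ennreal ((u x)\<^sup>2)) \<in> borel_measurable (\<mu> N)" using u by measurable
  then have eq: "(\<integral>\<^sup>+x. ennreal ((u x)\<^sup>2) \<partial>\<mu> N)
      = (\<integral>\<^sup>+x. ennreal ((u x)\<^sup>2) \<partial>unit_lborel) + ennreal (\<Sum>k=2..N+1. (u (real k))\<^sup>2)"
    by (subst nn_integral_\<mu>) (simp_all only: sum_ennreal zero_le_power2)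
  show ?thesis
    unfolding integrable_square_iff[OF u] integrable_square_iff[OF measurable_\<mu>_unit[OF u]] eq
    by (simp add: ennreal_add_less_top)
qed

text \<open>With square integrability stated for \<open>\<mu> N\<close> and the seminorm as an
  \<open>energy_on\<close>, the general closure results for L^2 norms and energies apply
  directly.\<close>

lemma hybrid_space_iff:
  "u \<in> hybrid_space N \<alpha> \<longleftrightarrow> u \<in> borel_measurable (\<mu> N) \<and> integrable (\<mu> N) (\<lambda>x. (u x)\<^sup>2)
     \<and> energy_on unit_lborel \<alpha> u < \<infinity>"
proof (cases "u \<in> borel_measurable (\<mu> N)")
  case True
  then show ?thesis
    unfolding hybrid_space_def frac_sobolev_def mem_Collect_eq
    by (simp only: integrable_square_\<mu>_iff gagliardo_sq_eq measurable_\<mu>_unit simp_thms)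
next
  case False
  then show ?thesis unfolding hybrid_space_def by blast
qed

lemma hybrid_spaceD:
  assumes "u \<in> hybrid_space N \<alpha>"
  shows "u \<in> borel_measurable (\<mu> N)" "integrable (\<mu> N) (\<lambda>x. (u x)\<^sup>2)"
    "energy_on unit_lborel \<alpha> u < \<infinity>" "u \<in> borel_measurable unit_lborel"
    "integrable unit_lborel (\<lambda>x. (u x)\<^sup>2)" "integrable unit_lborel u"
proof -
  interpret finite_measure unit_lborel by (rule finite_measure_unit_lborel)
  show u: "u \<in> borel_measurable (\<mu> N)" "integrable (\<mu> N) (\<lambda>x. (u x)\<^sup>2)"
    "energy_on unit_lborel \<alpha> u < \<infinity>"
    using assms unfolding hybrid_space_iff by blast+
  show 1: "u \<in> borel_measurable unit_lborel" by (rule measurable_\<mu>_unit) fact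
  show 2: "integrable unit_lborel (\<lambda>x. (u x)\<^sup>2)"
    using u integrable_square_\<mu>_iff by blast
  \<comment> \<open>On a finite measure space L^2 lies in L^1; this makes the mean a genuine,
    additive integral.\<close>
  show "integrable unit_lborel u"
    using 1 2 by (rule square_integrable_imp_integrable)
qed

lemma sigma_finite_\<mu>: "sigma_finite_measure (\<mu> N)"
  by (intro finite_measure.axioms(1) finite_measure_\<mu>)

lemma sigma_finite_unit_lborel: "sigma_finite_measure unit_lborel"
  by (intro finite_measure.axioms(1) finite_measure_unit_lborel)

lemma hybrid_space_add:
  assumes u: "u \<in> hybrid_space N \<alpha>" and w: "w \<in> hybrid_space N \<alpha>"
  shows "(\<lambda>x. u x + w x) \<in> hybrid_space N \<alpha>"
  unfolding hybrid_space_iff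
  by (intro conjI borel_measurable_add integrable_square_add energy_on_add_finite measurable_id_unit
    hybrid_spaceD[OF u] hybrid_spaceD[OF w])

lemma hybrid_space_cmult:
  assumes u: "u \<in> hybrid_space N \<alpha>"
  shows "(\<lambda>x. c * u x) \<in> hybrid_space N \<alpha>"
proof -
  have "energy_on unit_lborel \<alpha> (\<lambda>x. c * u x) < \<infinity>"
    unfolding energy_on_cmult[OF hybrid_spaceD(4)[OF u] measurable_id_unit]
    using hybrid_spaceD(3)[OF u] by (simp add: ennreal_mult_less_top)
  moreover have "integrable (\<mu> N) (\<lambda>x. (c * u x)\<^sup>2)"
    using hybrid_spaceD(2)[OF u] by (simp add: power_mult_distrib)
  ultimately show ?thesis
    using hybrid_spaceD(1)[OF u] unfolding hybrid_space_iff by simp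
qed

lemma hybrid_space_zero: "(\<lambda>x. 0) \<in> hybrid_space N \<alpha>"
proof -
  have "gagliardo_quotient \<alpha> (\<lambda>x. 0) = (\<lambda>x y. 0)"
    by (simp add: gagliardo_quotient_def fun_eq_iff)
  then show ?thesis by (simp add: hybrid_space_iff energy_on_def case_prod_beta')
qed

lemma hybrid_space_cong_AE:
  assumes u: "u \<in> hybrid_space N \<alpha>" and w: "w \<in> borel_measurable (\<mu> N)"
    and ae: "AE x in \<mu> N. w x = u x"
  shows "w \<in> hybrid_space N \<alpha>"
proof -
  have "integrable (\<mu> N) (\<lambda>x. (w x)\<^sup>2)"
  proof (rule integrable_cong_AE_imp[OF hybrid_spaceD(2)[OF u]])
    show "(\<lambda>x. (w x)\<^sup>2) \<in> borel_measurable (\<mu> N)" using w by measurable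
    show "AE x in \<mu> N. (u x)\<^sup>2 = (w x)\<^sup>2" using ae by eventually_elim simp
  qed
  moreover have "energy_on unit_lborel \<alpha> w = energy_on unit_lborel \<alpha> u"
    by (intro energy_on_cong_AE sigma_finite_unit_lborel measurable_id_unit hybrid_spaceD(4)[OF u]
      measurable_\<mu>_unit[OF w] AE_\<mu>_unit[OF ae])
  ultimately show ?thesis
    using w hybrid_spaceD(3)[OF u] by (simp add: hybrid_space_iff)
qed

section \<open>From seminorms to norms, and the components of the two norms\<close>

text \<open>Dominating the L^2 norm is what gives definiteness; the remaining norm laws are those of
  a seminorm, and the laws for the space have been shown above.\<close>

lemma norm_mod_ae_hybrid_spaceI:
  assumes n: "seminorm_mod_ae (\<mu> N) (hybrid_space N \<alpha>) n"
    and le: "\<And>u. u \<in> hybrid_space N \<alpha> \<Longrightarrow> l2_norm (\<mu> N) u \<le> n u"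
  shows "norm_mod_ae (\<mu> N) (hybrid_space N \<alpha>) n"
  unfolding norm_mod_ae_def
proof (intro conjI ballI allI impI)
  show "hybrid_space N \<alpha> \<subseteq> borel_measurable (\<mu> N)"
    by (rule subsetI) (rule hybrid_spaceD)
  show "(\<lambda>x. 0) \<in> hybrid_space N \<alpha>" by (rule hybrid_space_zero)
next
  fix u w assume u: "u \<in> hybrid_space N \<alpha>" and w: "w \<in> hybrid_space N \<alpha>"
  show "(\<lambda>x. u x + w x) \<in> hybrid_space N \<alpha>" by (rule hybrid_space_add[OF u w])
  show "n (\<lambda>x. u x + w x) \<le> n u + n w" by (rule seminorm_mod_ae_triangle[OF n u w])
next
  fix u w assume u: "u \<in> hybrid_space N \<alpha>" and w: "w \<in> borel_measurable (\<mu> N)"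
    and ae: "AE x in \<mu> N. w x = u x"
  show w': "w \<in> hybrid_space N \<alpha>" by (rule hybrid_space_cong_AE[OF u w ae])
  show "n w = n u" by (rule seminorm_mod_ae_cong[OF n u w' ae])
next
  fix c u assume u: "u \<in> hybrid_space N \<alpha>"
  show "(\<lambda>x. c * u x) \<in> hybrid_space N \<alpha>" by (rule hybrid_space_cmult[OF u])
  show "n (\<lambda>x. c * u x) = \<bar>c\<bar> * n u" by (rule seminorm_mod_ae_cmult[OF n u])
next
  fix u assume u: "u \<in> hybrid_space N \<alpha>"
  show "0 \<le> n u" by (rule seminorm_mod_ae_nonneg[OF n])
  show "n u = 0 \<longleftrightarrow> (AE x in \<mu> N. u x = 0)"
  proof
    assume "n u = 0"
    with le[OF u] l2_norm_nonneg[of "\<mu> N" u] have "l2_norm (\<mu> N) u = 0" by simp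
    then have "(\<integral>x. (u x)\<^sup>2 \<partial>\<mu> N) = 0" by (simp add: l2_norm_def)
    then have "AE x in \<mu> N. (u x)\<^sup>2 = 0"
      using hybrid_spaceD(2)[OF u] by (simp add: integral_nonneg_eq_0_iff_AE)
    then show "AE x in \<mu> N. u x = 0" by simp
  next
    assume "AE x in \<mu> N. u x = 0"
    then have "n u = n (\<lambda>x. 0)"
      by (rule seminorm_mod_ae_cong[OF n hybrid_space_zero u])
    \<comment> \<open>Homogeneity with factor 0 shows that the seminorm of the zero function
      vanishes.\<close>
    also have "\<dots> = n (\<lambda>x. 0 * u x)" by simp
    also have "\<dots> = 0" using seminorm_mod_ae_cmult[OF n u, of 0] by simp
    finally show "n u = 0" .
  qed
qed

lemma seminorm_l2_norm: "seminorm_mod_ae (\<mu> N) (hybrid_space N \<alpha>) (l2_norm (\<mu> N))"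
  unfolding seminorm_mod_ae_def
proof (intro conjI ballI allI impI)
  fix u w assume u: "u \<in> hybrid_space N \<alpha>" and w: "w \<in> hybrid_space N \<alpha>"
  show "l2_norm (\<mu> N) (\<lambda>x. u x + w x) \<le> l2_norm (\<mu> N) u + l2_norm (\<mu> N) w"
    by (intro l2_norm_triangle hybrid_spaceD[OF u] hybrid_spaceD[OF w])
  show "l2_norm (\<mu> N) w = l2_norm (\<mu> N) u" if "AE x in \<mu> N. w x = u x"
    by (intro l2_norm_cong_AE hybrid_spaceD(1)[OF u] hybrid_spaceD(1)[OF w] that)
qed (rule l2_norm_nonneg l2_norm_cmult)+

text \<open>Two measures occur because a.e. classes are always taken with respect to
  \<open>L = \<mu> N\<close>, whereas the energy may live on \<open>M = unit_lborel\<close>.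
  Finiteness on \<open>V\<close> keeps \<open>enn2real\<close> faithful in the triangle
  inequality.\<close>

lemma seminorm_energy_on:
  assumes M: "sigma_finite_measure M" "(\<lambda>x. x) \<in> borel_measurable M"
    and meas: "\<And>u. u \<in> V \<Longrightarrow> u \<in> borel_measurable M"
    and fin: "\<And>u. u \<in> V \<Longrightarrow> energy_on M \<alpha> u < \<infinity>"
    and ae: "\<And>P. AE x in L. P x \<Longrightarrow> AE x in M. P x"
  shows "seminorm_mod_ae L V (\<lambda>u. sqrt (enn2real (energy_on M \<alpha> u)))"
  unfolding seminorm_mod_ae_def
proof (intro conjI ballI allI impI)
  fix u
  show "0 \<le> sqrt (enn2real (energy_on M \<alpha> u))" by simp
next
  fix u w assume uw: "u \<in> V" "w \<in> V"
  show "sqrt (enn2real (energy_on M \<alpha> (\<lambda>x. u x + w x)))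
      \<le> sqrt (enn2real (energy_on M \<alpha> u)) + sqrt (enn2real (energy_on M \<alpha> w))"
    by (intro sqrt_energy_on_triangle M meas fin uw)
  show "sqrt (enn2real (energy_on M \<alpha> w)) = sqrt (enn2real (energy_on M \<alpha> u))"
    if "AE x in L. w x = u x"
    by (simp only: energy_on_cong_AE[OF M meas[OF uw(1)] meas[OF uw(2)] ae[OF that]])
next
  fix c u assume u: "u \<in> V"
  show "sqrt (enn2real (energy_on M \<alpha> (\<lambda>x. c * u x))) = \<bar>c\<bar> * sqrt (enn2real (energy_on M \<alpha> u))"
    unfolding energy_on_cmult[OF meas[OF u] M(2)]
    by (simp add: enn2real_mult real_sqrt_mult)
qed

lemma
  assumes u: "u \<in> hybrid_space N \<alpha>" and w: "w \<in> hybrid_space N \<alpha>"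
  shows unit_mean_add: "unit_mean (\<lambda>x. u x + w x) = unit_mean u + unit_mean w"
    and unit_mean_cong_AE: "AE x in \<mu> N. w x = u x \<Longrightarrow> unit_mean w = unit_mean u"
proof -
  show "unit_mean (\<lambda>x. u x + w x) = unit_mean u + unit_mean w"
    unfolding unit_mean_def
    by (rule Bochner_Integration.integral_add[OF hybrid_spaceD(6)[OF u] hybrid_spaceD(6)[OF w]])
  show "unit_mean w = unit_mean u" if "AE x in \<mu> N. w x = u x"
    unfolding unit_mean_def
    by (rule integral_cong_AE[OF hybrid_spaceD(4)[OF w] hybrid_spaceD(4)[OF u] AE_\<mu>_unit[OF that]])
qed

lemma unit_mean_cmult: "unit_mean (\<lambda>x. c * u x) = c * unit_mean u"
  by (simp add: unit_mean_def)

lemma integrable_square_diff_const: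
  assumes u: "u \<in> hybrid_space N \<alpha>"
  shows "integrable unit_lborel (\<lambda>x. (u x - c)\<^sup>2)"
proof -
  interpret finite_measure unit_lborel by (rule finite_measure_unit_lborel)
  show ?thesis
    using integrable_square_add[OF hybrid_spaceD(4)[OF u] borel_measurable_const hybrid_spaceD(5)[OF u], of "- c"]
    by simp
qed

text \<open>The map from \<open>u\<close> to \<open>u - unit_mean u\<close> is linear and respects
  a.e. equality, so the L^2 norm of its value inherits the seminorm laws.\<close>

lemma seminorm_l2_deviation:
  "seminorm_mod_ae (\<mu> N) (hybrid_space N \<alpha>) (\<lambda>u. l2_norm unit_lborel (\<lambda>x. u x - unit_mean u))"
  unfolding seminorm_mod_ae_def
proof (intro conjI ballI allI impI)
  fix u w assume u: "u \<in> hybrid_space N \<alpha>" and w: "w \<in> hybrid_space N \<alpha>"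
  note m = hybrid_spaceD(4)[OF u] hybrid_spaceD(4)[OF w]
  have m': "(\<lambda>x. u x - c) \<in> borel_measurable unit_lborel" "(\<lambda>x. w x - c) \<in> borel_measurable unit_lborel" for c
    by (intro borel_measurable_diff m borel_measurable_const)+
  have "l2_norm unit_lborel (\<lambda>x. (u x - unit_mean u) + (w x - unit_mean w))
      \<le> l2_norm unit_lborel (\<lambda>x. u x - unit_mean u) + l2_norm unit_lborel (\<lambda>x. w x - unit_mean w)"
    by (intro l2_norm_triangle m' integrable_square_diff_const[OF u] integrable_square_diff_const[OF w])
  then show "l2_norm unit_lborel (\<lambda>x. (u x + w x) - unit_mean (\<lambda>x. u x + w x))
      \<le> l2_norm unit_lborel (\<lambda>x. u x - unit_mean u) + l2_norm unit_lborel (\<lambda>x. w x - unit_mean w)"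
    unfolding unit_mean_add[OF u w] by (simp only: add_diff_add)
  show "l2_norm unit_lborel (\<lambda>x. w x - unit_mean w) = l2_norm unit_lborel (\<lambda>x. u x - unit_mean u)"
    if "AE x in \<mu> N. w x = u x"
    unfolding unit_mean_cong_AE[OF u w that]
  proof (rule l2_norm_cong_AE[OF m'(2) m'(1)])
    show "AE x in unit_lborel. w x - unit_mean u = u x - unit_mean u"
      using AE_\<mu>_unit[OF that] by eventually_elim simp
  qed
next
  fix c u
  show "l2_norm unit_lborel (\<lambda>x. c * u x - unit_mean (\<lambda>x. c * u x))
      = \<bar>c\<bar> * l2_norm unit_lborel (\<lambda>x. u x - unit_mean u)"
    unfolding unit_mean_cmult right_diff_distrib[symmetric] by (rule l2_norm_cmult)
qed (rule l2_norm_nonneg)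

lemma seminorm_point_deviation:
  assumes k: "k \<in> {2..N+1}"
  shows "seminorm_mod_ae (\<mu> N) (hybrid_space N \<alpha>) (\<lambda>u. \<bar>u (real k) - unit_mean u\<bar>)"
  unfolding seminorm_mod_ae_def
proof (intro conjI ballI allI impI)
  fix u w assume u: "u \<in> hybrid_space N \<alpha>" and w: "w \<in> hybrid_space N \<alpha>"
  show "\<bar>u (real k) + w (real k) - unit_mean (\<lambda>x. u x + w x)\<bar>
      \<le> \<bar>u (real k) - unit_mean u\<bar> + \<bar>w (real k) - unit_mean w\<bar>"
    unfolding unit_mean_add[OF u w] by linarith
  show "\<bar>w (real k) - unit_mean w\<bar> = \<bar>u (real k) - unit_mean u\<bar>" if "AE x in \<mu> N. w x = u x"
    using unit_mean_cong_AE[OF u w that] AE_\<mu>_point[OF that k] by simp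
next
  fix c u
  show "\<bar>c * u (real k) - unit_mean (\<lambda>x. c * u x)\<bar> = \<bar>c\<bar> * \<bar>u (real k) - unit_mean u\<bar>"
    unfolding unit_mean_cmult right_diff_distrib[symmetric] by (rule abs_mult)
qed simp

text \<open>The four summands are nested as square roots of two squares, the shape that
  \<open>seminorm_mod_ae_sqrt\<close> produces.\<close>

lemma star_norm_eq:
  assumes u: "u \<in> borel_measurable (\<mu> N)"
  shows "star_norm N \<alpha> u = sqrt ((sqrt ((sqrt ((l2_norm (\<mu> N) u)\<^sup>2
      + (sqrt (enn2real (energy_on unit_lborel \<alpha> u)))\<^sup>2))\<^sup>2
      + (l2_norm unit_lborel (\<lambda>x. u x - unit_mean u))\<^sup>2))\<^sup>2
      + (L2_set (\<lambda>k. \<bar>u (real k) - unit_mean u\<bar>) {2..N+1})\<^sup>2)"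
  unfolding star_norm_def gagliardo_sq_eq[OF u] L2_set_def
  by (simp add: sum_nonneg del: sum.cl_ivl_Suc)

text \<open>The nested form of \<open>star_norm\<close> is established for measurable functions
  only, so the seminorm laws must pass along an equality that is available on
  \<open>V\<close>.\<close>

lemma seminorm_mod_ae_transfer:
  assumes "seminorm_mod_ae M V p" "\<And>u. 0 \<le> q u" "\<And>u. u \<in> V \<Longrightarrow> q u = p u"
    and "\<And>u w. u \<in> V \<Longrightarrow> w \<in> V \<Longrightarrow> (\<lambda>x. u x + w x) \<in> V" "\<And>c u. u \<in> V \<Longrightarrow> (\<lambda>x. c * u x) \<in> V"
  shows "seminorm_mod_ae M V q"
  unfolding seminorm_mod_ae_def
proof (intro conjI ballI allI impI)
  fix u w assume uw: "u \<in> V" "w \<in> V"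
  show "q (\<lambda>x. u x + w x) \<le> q u + q w"
    unfolding assms(3)[OF uw(1)] assms(3)[OF uw(2)] assms(3)[OF assms(4)[OF uw]]
    by (rule seminorm_mod_ae_triangle[OF assms(1) uw])
  show "q w = q u" if "AE x in M. w x = u x"
    unfolding assms(3)[OF uw(1)] assms(3)[OF uw(2)] by (rule seminorm_mod_ae_cong[OF assms(1) uw that])
next
  fix c u assume u: "u \<in> V"
  show "q (\<lambda>x. c * u x) = \<bar>c\<bar> * q u"
    unfolding assms(3)[OF u] assms(3)[OF assms(5)[OF u]] by (rule seminorm_mod_ae_cmult[OF assms(1) u])
qed (rule assms(2))

lemma seminorm_star_norm: "seminorm_mod_ae (\<mu> N) (hybrid_space N \<alpha>) (star_norm N \<alpha>)"
proof (rule seminorm_mod_ae_transfer)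
  show "seminorm_mod_ae (\<mu> N) (hybrid_space N \<alpha>) (\<lambda>u. sqrt ((sqrt ((sqrt ((l2_norm (\<mu> N) u)\<^sup>2
      + (sqrt (enn2real (energy_on unit_lborel \<alpha> u)))\<^sup>2))\<^sup>2
      + (l2_norm unit_lborel (\<lambda>x. u x - unit_mean u))\<^sup>2))\<^sup>2
      + (L2_set (\<lambda>k. \<bar>u (real k) - unit_mean u\<bar>) {2..N+1})\<^sup>2))"
    by (intro seminorm_mod_ae_sqrt seminorm_mod_ae_L2_set seminorm_l2_norm seminorm_energy_on
      seminorm_l2_deviation seminorm_point_deviation sigma_finite_unit_lborel measurable_id_unit AE_\<mu>_unit)
      (auto dest: hybrid_spaceD)
  show "star_norm N \<alpha> u = sqrt ((sqrt ((sqrt ((l2_norm (\<mu> N) u)\<^sup>2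
      + (sqrt (enn2real (energy_on unit_lborel \<alpha> u)))\<^sup>2))\<^sup>2
      + (l2_norm unit_lborel (\<lambda>x. u x - unit_mean u))\<^sup>2))\<^sup>2
      + (L2_set (\<lambda>k. \<bar>u (real k) - unit_mean u\<bar>) {2..N+1})\<^sup>2)" if "u \<in> hybrid_space N \<alpha>" for u
    by (rule star_norm_eq[OF hybrid_spaceD(1)[OF that]])
  show "0 \<le> star_norm N \<alpha> u" for u
    by (simp add: star_norm_def add_nonneg_nonneg sum_nonneg del: sum.cl_ivl_Suc)
qed (rule hybrid_space_add hybrid_space_cmult; assumption)+

section \<open>Splitting the energy into continuous, mixed and discrete parts\<close>

text \<open>The outer variable \<open>y\<close> comes first in the pair, as required for the
  measurability of the inner integral as a function of \<open>y\<close>.\<close>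

lemma measurable_gagliardo_kernel:
  assumes [measurable]: "u \<in> borel_measurable M" "u \<in> borel_measurable L"
    and [measurable]: "(\<lambda>x. x) \<in> borel_measurable M" "(\<lambda>x. x) \<in> borel_measurable L"
  shows "(\<lambda>(y, x). ennreal (gagliardo_kernel \<alpha> u x y)) \<in> borel_measurable (M \<Otimes>\<^sub>M L)"
  unfolding gagliardo_kernel_def by measurable

lemma measurable_gagliardo_kernel_left:
  assumes [measurable]: "u \<in> borel_measurable M" "(\<lambda>x. x) \<in> borel_measurable M"
  shows "(\<lambda>x. ennreal (gagliardo_kernel \<alpha> u x y)) \<in> borel_measurable M"
  unfolding gagliardo_kernel_def by measurable

text \<open>After Tonelli, \<open>nn_integral_\<mu>\<close> is applied in each variable, which gives
  four terms. The two mixed ones agree by symmetry of the kernel; hence the factor 2.\<close>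

lemma energy_split:
  assumes u: "u \<in> borel_measurable (\<mu> N)"
  shows "energy N \<alpha> u = energy_on unit_lborel \<alpha> u
    + 2 * (\<Sum>k=2..N+1. \<integral>\<^sup>+x. ennreal (gagliardo_kernel \<alpha> u x (real k)) \<partial>unit_lborel)
    + (\<Sum>j=2..N+1. \<Sum>k=2..N+1. ennreal (gagliardo_kernel \<alpha> u (real k) (real j)))"
proof -
  define K where "K x y = ennreal (gagliardo_kernel \<alpha> u x y)" for x y
  have K_commute: "K x y = K y x" for x y
    by (simp add: K_def gagliardo_kernel_commute)
  note u' = measurable_\<mu>_unit[OF u]
  interpret U: sigma_finite_measure unit_lborel by (rule sigma_finite_unit_lborel)
  interpret M: sigma_finite_measure "\<mu> N" by (rule sigma_finite_\<mu>)
  have K_left: "(\<lambda>x. K x y) \<in> borel_measurable (\<mu> N)" for y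
    unfolding K_def by (rule measurable_gagliardo_kernel_left[OF u measurable_id_\<mu>])
  have K_right: "K x \<in> borel_measurable unit_lborel" for x
    using measurable_gagliardo_kernel_left[OF u' measurable_id_unit, of \<alpha> x]
    by (simp add: K_def gagliardo_kernel_commute[of \<alpha> u x] cong: measurable_cong)
  have inner_measurable: "(\<lambda>y. \<integral>\<^sup>+x. K x y \<partial>\<mu> N) \<in> borel_measurable (\<mu> N)"
    unfolding K_def
    by (rule M.borel_measurable_nn_integral[OF measurable_gagliardo_kernel[OF u u measurable_id_\<mu> measurable_id_\<mu>]])
  have unit_measurable: "(\<lambda>y. \<integral>\<^sup>+x. K x y \<partial>unit_lborel) \<in> borel_measurable unit_lborel"
    unfolding K_def
    by (rule U.borel_measurable_nn_integral[OF measurable_gagliardo_kernel[OF u' u' measurable_id_unit measurable_id_unit]])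
  have inner: "(\<integral>\<^sup>+x. K x y \<partial>\<mu> N) = (\<integral>\<^sup>+x. K x y \<partial>unit_lborel) + (\<Sum>k=2..N+1. K (real k) y)" for y
    by (rule nn_integral_\<mu>[OF K_left])
  have "energy N \<alpha> u = (\<integral>\<^sup>+y. (\<integral>\<^sup>+x. K x y \<partial>\<mu> N) \<partial>\<mu> N)"
    unfolding energy_eq energy_on_iterated[OF M.sigma_finite_measure_axioms u measurable_id_\<mu>] K_def ..
  also have "\<dots> = (\<integral>\<^sup>+y. (\<integral>\<^sup>+x. K x y \<partial>\<mu> N) \<partial>unit_lborel) + (\<Sum>j=2..N+1. \<integral>\<^sup>+x. K x (real j) \<partial>\<mu> N)"
    by (rule nn_integral_\<mu>[OF inner_measurable])
  also have "(\<Sum>j=2..N+1. \<integral>\<^sup>+x. K x (real j) \<partial>\<mu> N) = (\<Sum>j=2..N+1. \<integral>\<^sup>+x. K x (real j) \<partial>unit_lborel)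
      + (\<Sum>j=2..N+1. \<Sum>k=2..N+1. K (real k) (real j))"
    unfolding inner by (rule sum.distrib)
  also have "(\<integral>\<^sup>+y. (\<integral>\<^sup>+x. K x y \<partial>\<mu> N) \<partial>unit_lborel)
      = (\<integral>\<^sup>+y. (\<integral>\<^sup>+x. K x y \<partial>unit_lborel) \<partial>unit_lborel) + (\<integral>\<^sup>+y. (\<Sum>k=2..N+1. K (real k) y) \<partial>unit_lborel)"
    unfolding inner by (intro nn_integral_add unit_measurable borel_measurable_sum K_right)
  also have "(\<integral>\<^sup>+y. (\<integral>\<^sup>+x. K x y \<partial>unit_lborel) \<partial>unit_lborel) = energy_on unit_lborel \<alpha> u"
    unfolding energy_on_iterated[OF U.sigma_finite_measure_axioms u' measurable_id_unit] K_def ..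
  also have "(\<integral>\<^sup>+y. (\<Sum>k=2..N+1. K (real k) y) \<partial>unit_lborel)
      = (\<Sum>k=2..N+1. \<integral>\<^sup>+y. K (real k) y \<partial>unit_lborel)"
    by (intro nn_integral_sum K_right)
  also have "\<dots> = (\<Sum>k=2..N+1. \<integral>\<^sup>+x. K x (real k) \<partial>unit_lborel)"
    by (simp only: K_commute[of "real _"])
  finally show ?thesis
    unfolding K_def by (simp only: mult_2 add.assoc)
qed

section \<open>Bounds for the mixed and discrete parts\<close>

lemma gagliardo_kernel_le:
  assumes "0 < \<alpha>" "1 \<le> \<bar>x - y\<bar>"
  shows "gagliardo_kernel \<alpha> u x y \<le> (u x - u y)\<^sup>2"
proof -
  have "1 \<le> \<bar>x - y\<bar> powr (1 + 2 * \<alpha>)" using assms by (intro ge_one_powr_ge_zero) auto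
  then show ?thesis
    by (auto simp: gagliardo_kernel_def divide_le_eq mult_le_cancel_left1 not_less power2_eq_square
      intro: mult_right_mono order_trans[rotated])
qed

text \<open>Since \<alpha> < 1, the exponent is below 3. With base at least 1 this gives the
  denominator bound \<open>R ^ 3\<close>, independent of \<alpha>.\<close>

lemma gagliardo_kernel_ge:
  assumes "0 < \<alpha>" "\<alpha> < 1" "1 \<le> \<bar>x - y\<bar>" "\<bar>x - y\<bar> \<le> R"
  shows "(u x - u y)\<^sup>2 / R ^ 3 \<le> gagliardo_kernel \<alpha> u x y"
proof -
  have R: "1 \<le> R" using assms by linarith
  have "\<bar>x - y\<bar> powr (1 + 2 * \<alpha>) \<le> R powr (1 + 2 * \<alpha>)"
    using assms by (intro powr_mono2) auto
  also have "\<dots> \<le> R powr 3"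
    using assms R by (intro powr_mono) auto
  also have "\<dots> = R ^ 3" using R by (simp add: powr_numeral)
  finally have "\<bar>x - y\<bar> powr (1 + 2 * \<alpha>) \<le> R ^ 3" .
  moreover have "0 < \<bar>x - y\<bar> powr (1 + 2 * \<alpha>)" "x \<noteq> y" using assms by auto
  ultimately show ?thesis
    by (simp add: gagliardo_kernel_def frac_le)
qed

text \<open>Expand the square around the mean. The interval has mass 1, so the linear term
  integrates to 0 and the constant term to itself: variance plus squared bias.\<close>

lemma nn_integral_square_diff_const:
  assumes u: "u \<in> hybrid_space N \<alpha>"
  shows "(\<integral>\<^sup>+x. ennreal ((u x - c)\<^sup>2) \<partial>unit_lborel)
    = ennreal ((l2_norm unit_lborel (\<lambda>x. u x - unit_mean u))\<^sup>2 + (c - unit_mean u)\<^sup>2)"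
proof -
  interpret finite_measure unit_lborel by (rule finite_measure_unit_lborel)
  let ?m = "unit_mean u"
  have one: "measure unit_lborel (space unit_lborel) = 1"
    by (simp add: measure_restrict_space space_restrict_space)
  note [simp] = hybrid_spaceD(6)[OF u] integrable_square_diff_const[OF u]
  have "(\<integral>x. u x - ?m \<partial>unit_lborel) = 0"
    using one by (simp add: unit_mean_def)
  then have "(\<integral>x. (u x - ?m)\<^sup>2 + (2 * (?m - c) * (u x - ?m) + (c - ?m)\<^sup>2) \<partial>unit_lborel)
      = (\<integral>x. (u x - ?m)\<^sup>2 \<partial>unit_lborel) + (c - ?m)\<^sup>2"
    using one by simp
  moreover have "(u x - c)\<^sup>2 = (u x - ?m)\<^sup>2 + (2 * (?m - c) * (u x - ?m) + (c - ?m)\<^sup>2)" for x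
    by (simp add: power2_eq_square algebra_simps)
  ultimately have "(\<integral>x. (u x - c)\<^sup>2 \<partial>unit_lborel) = (\<integral>x. (u x - ?m)\<^sup>2 \<partial>unit_lborel) + (c - ?m)\<^sup>2"
    by simp
  then show ?thesis
    by (simp add: nn_integral_eq_integral l2_norm_def)
qed

lemma
  assumes u: "u \<in> hybrid_space N \<alpha>" and \<alpha>: "0 < \<alpha>" "\<alpha> < 1" and k: "k \<in> {2..N+1}"
  defines "S \<equiv> (l2_norm unit_lborel (\<lambda>x. u x - unit_mean u))\<^sup>2 + (u (real k) - unit_mean u)\<^sup>2"
  shows cross_energy_le: "(\<integral>\<^sup>+x. ennreal (gagliardo_kernel \<alpha> u x (real k)) \<partial>unit_lborel) \<le> ennreal S"
    and cross_energy_ge: "ennreal (S / (real N + 1) ^ 3)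
      \<le> (\<integral>\<^sup>+x. ennreal (gagliardo_kernel \<alpha> u x (real k)) \<partial>unit_lborel)"
proof -
  \<comment> \<open>The extreme distances are those from 1 to 2 and from 0 to
    \<open>N + 1\<close>.\<close>
  have far: "1 \<le> \<bar>x - real k\<bar>" "\<bar>x - real k\<bar> \<le> real N + 1" if "x \<in> space unit_lborel" for x
    using that k by (auto simp: space_restrict_space)
  have "(\<integral>\<^sup>+x. ennreal (gagliardo_kernel \<alpha> u x (real k)) \<partial>unit_lborel)
      \<le> (\<integral>\<^sup>+x. ennreal ((u x - u (real k))\<^sup>2) \<partial>unit_lborel)"
    by (intro nn_integral_mono ennreal_leI gagliardo_kernel_le far \<alpha>)
  then show "(\<integral>\<^sup>+x. ennreal (gagliardo_kernel \<alpha> u x (real k)) \<partial>unit_lborel) \<le> ennreal S"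
    unfolding nn_integral_square_diff_const[OF u] S_def .
  have m: "(\<lambda>x. ennreal ((u x - u (real k))\<^sup>2)) \<in> borel_measurable unit_lborel"
    using hybrid_spaceD(4)[OF u] by simp
  have "ennreal (S / (real N + 1) ^ 3) = ennreal (1 / (real N + 1) ^ 3) * ennreal S"
    by (subst ennreal_mult[symmetric]) (simp_all add: S_def)
  also have "\<dots> = (\<integral>\<^sup>+x. ennreal (1 / (real N + 1) ^ 3) * ennreal ((u x - u (real k))\<^sup>2) \<partial>unit_lborel)"
    unfolding nn_integral_cmult[OF m] nn_integral_square_diff_const[OF u] S_def ..
  also have "\<dots> = (\<integral>\<^sup>+x. ennreal ((u x - u (real k))\<^sup>2 / (real N + 1) ^ 3) \<partial>unit_lborel)"
    by (intro nn_integral_cong) (simp flip: ennreal_mult)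
  also have "\<dots> \<le> (\<integral>\<^sup>+x. ennreal (gagliardo_kernel \<alpha> u x (real k)) \<partial>unit_lborel)"
    by (intro nn_integral_mono ennreal_leI gagliardo_kernel_ge far \<alpha>)
  finally show "ennreal (S / (real N + 1) ^ 3)
      \<le> (\<integral>\<^sup>+x. ennreal (gagliardo_kernel \<alpha> u x (real k)) \<partial>unit_lborel)" .
qed

text \<open>Distinct integers are at distance at least 1, so the kernel is at most the squared
  difference, which is then compared through \<open>m\<close>. In the double sum over
  \<open>N\<close> points each squared deviation is counted \<open>2 * N\<close> times from either
  index.\<close>

lemma discrete_energy_le:
  assumes "0 < \<alpha>"
  shows "(\<Sum>j=2..N+1. \<Sum>k=2..N+1. gagliardo_kernel \<alpha> u (real k) (real j))
    \<le> 4 * real N * (\<Sum>k=2..N+1. (u (real k) - m)\<^sup>2)"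
proof -
  let ?d = "\<lambda>k. (u (real k) - m)\<^sup>2"
  have "gagliardo_kernel \<alpha> u (real k) (real j) \<le> 2 * ?d k + 2 * ?d j" for j k
  proof (cases "j = k")
    case True
    then show ?thesis by (simp add: gagliardo_kernel_def)
  next
    case False
    then have "gagliardo_kernel \<alpha> u (real k) (real j) \<le> (u (real k) - u (real j))\<^sup>2"
      using assms by (intro gagliardo_kernel_le) linarith+
    also have "\<dots> = ((u (real k) - m) + (m - u (real j)))\<^sup>2" by simp
    also have "\<dots> \<le> 2 * ?d k + 2 * (m - u (real j))\<^sup>2"
      using square_sum_le_weighted[of 1 1 "u (real k) - m" "m - u (real j)"] by simp
    finally show ?thesis by (simp only: power2_commute[of m])
  qed
  then have "(\<Sum>j=2..N+1. \<Sum>k=2..N+1. gagliardo_kernel \<alpha> u (real k) (real j))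
      \<le> (\<Sum>j=2..N+1. \<Sum>k=2..N+1. 2 * ?d k + 2 * ?d j)"
    by (intro sum_mono)
  also have "\<dots> = 4 * real N * (\<Sum>k=2..N+1. ?d k)"
    by (simp add: sum.distrib sum_distrib_left[symmetric] algebra_simps del: sum.cl_ivl_Suc)
  finally show ?thesis .
qed

text \<open>Summing the mixed bounds over the \<open>N\<close> points counts the variance
  \<open>P\<close> once per point, whence \<open>real N * P + D\<close>. The upper bound adds the
  discrete estimate.\<close>

lemma
  assumes u: "u \<in> hybrid_space N \<alpha>" and \<alpha>: "0 < \<alpha>" "\<alpha> < 1"
  defines "G \<equiv> enn2real (energy_on unit_lborel \<alpha> u)"
    and "P \<equiv> (l2_norm unit_lborel (\<lambda>x. u x - unit_mean u))\<^sup>2"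
    and "D \<equiv> (\<Sum>k=2..N+1. (u (real k) - unit_mean u)\<^sup>2)"
  shows energy_le: "energy N \<alpha> u \<le> ennreal (G + 2 * (real N * P + D) + 4 * real N * D)"
    and energy_ge: "ennreal (G + 2 * ((real N * P + D) / (real N + 1) ^ 3)) \<le> energy N \<alpha> u"
proof -
  let ?X = "\<lambda>k. \<integral>\<^sup>+x. ennreal (gagliardo_kernel \<alpha> u x (real k)) \<partial>unit_lborel"
  have nonneg: "0 \<le> G" "0 \<le> P" "0 \<le> D"
    unfolding G_def P_def D_def by (simp_all add: sum_nonneg del: sum.cl_ivl_Suc)
  have G: "energy_on unit_lborel \<alpha> u = ennreal G"
    using hybrid_spaceD(3)[OF u] by (simp add: G_def)
  have sum_S: "(\<Sum>k=2..N+1. P + (u (real k) - unit_mean u)\<^sup>2) = real N * P + D"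
    unfolding D_def sum.distrib by (simp del: sum.cl_ivl_Suc)
  have P_plus: "0 \<le> P + (u (real k) - unit_mean u)\<^sup>2" for k
    using nonneg by simp
  have "(\<Sum>k=2..N+1. ?X k) \<le> (\<Sum>k=2..N+1. ennreal (P + (u (real k) - unit_mean u)\<^sup>2))"
    unfolding P_def by (intro sum_mono cross_energy_le[OF u \<alpha>])
  also have "\<dots> = ennreal (real N * P + D)"
    unfolding sum_S[symmetric] by (rule sum_ennreal) (rule P_plus)
  finally have X_le: "(\<Sum>k=2..N+1. ?X k) \<le> ennreal (real N * P + D)" .
  have "ennreal ((real N * P + D) / (real N + 1) ^ 3)
      = (\<Sum>k=2..N+1. ennreal ((P + (u (real k) - unit_mean u)\<^sup>2) / (real N + 1) ^ 3))"
    unfolding sum_S[symmetric] sum_divide_distrib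
    by (rule sum_ennreal[symmetric]) (intro divide_nonneg_nonneg P_plus, simp)
  also have "\<dots> \<le> (\<Sum>k=2..N+1. ?X k)"
    unfolding P_def by (intro sum_mono cross_energy_ge[OF u \<alpha>])
  finally have X_ge: "ennreal ((real N * P + D) / (real N + 1) ^ 3) \<le> (\<Sum>k=2..N+1. ?X k)" .
  have "(\<Sum>j=2..N+1. \<Sum>k=2..N+1. ennreal (gagliardo_kernel \<alpha> u (real k) (real j)))
      = ennreal (\<Sum>j=2..N+1. \<Sum>k=2..N+1. gagliardo_kernel \<alpha> u (real k) (real j))"
    by (simp only: sum_ennreal gagliardo_kernel_nonneg sum_nonneg)
  also have "\<dots> \<le> ennreal (4 * real N * D)"
    unfolding D_def by (intro ennreal_leI discrete_energy_le \<alpha>)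
  finally have discrete: "(\<Sum>j=2..N+1. \<Sum>k=2..N+1. ennreal (gagliardo_kernel \<alpha> u (real k) (real j)))
      \<le> ennreal (4 * real N * D)" .
  have two: "2 * ennreal x = ennreal (2 * x)" if "0 \<le> x" for x
    using that by (simp add: ennreal_mult)
  have "energy N \<alpha> u \<le> ennreal G + 2 * ennreal (real N * P + D) + ennreal (4 * real N * D)"
    unfolding energy_split[OF hybrid_spaceD(1)[OF u]] G
    by (intro add_mono mult_left_mono X_le discrete) simp_all
  also have "\<dots> = ennreal (G + 2 * (real N * P + D) + 4 * real N * D)"
    using nonneg by (simp add: two flip: ennreal_plus)
  finally show "energy N \<alpha> u \<le> ennreal (G + 2 * (real N * P + D) + 4 * real N * D)" .
  \<comment> \<open>The summand 0 is the lower bound for the nonnegative discrete part.\<close>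
  have "ennreal (G + 2 * ((real N * P + D) / (real N + 1) ^ 3))
      = ennreal G + 2 * ennreal ((real N * P + D) / (real N + 1) ^ 3) + 0"
    using nonneg by (simp add: two flip: ennreal_plus)
  also have "\<dots> \<le> energy N \<alpha> u"
    unfolding energy_split[OF hybrid_spaceD(1)[OF u]] G
    by (intro add_mono mult_left_mono X_ge) simp_all
  finally show "ennreal (G + 2 * ((real N * P + D) / (real N + 1) ^ 3)) \<le> energy N \<alpha> u" .
qed

text \<open>This ensures that \<open>enn2real\<close> in \<open>energy_norm\<close> never replaces
  an infinite energy by 0.\<close>

lemma energy_finite:
  assumes "u \<in> hybrid_space N \<alpha>" "0 < \<alpha>" "\<alpha> < 1"
  shows "energy N \<alpha> u < \<infinity>"
  using le_less_trans[OF energy_le[OF assms] ennreal_less_top] by simp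

lemma seminorm_energy_norm:
  assumes "0 < \<alpha>" "\<alpha> < 1"
  shows "seminorm_mod_ae (\<mu> N) (hybrid_space N \<alpha>) (energy_norm N \<alpha>)"
proof -
  have eq: "energy_norm N \<alpha> = (\<lambda>u. sqrt ((l2_norm (\<mu> N) u)\<^sup>2
      + (sqrt (enn2real (energy_on (\<mu> N) \<alpha> u)))\<^sup>2))"
    by (rule ext) (simp add: energy_norm_def energy_eq)
  show ?thesis
    unfolding eq
  proof (intro seminorm_mod_ae_sqrt seminorm_l2_norm seminorm_energy_on sigma_finite_\<mu> measurable_id_\<mu>)
    fix u assume "u \<in> hybrid_space N \<alpha>"
    then show "u \<in> borel_measurable (\<mu> N)" "energy_on (\<mu> N) \<alpha> u < \<infinity>"
      using hybrid_spaceD(1) energy_finite[OF _ assms] by (simp_all add: energy_eq)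
  qed
qed

section \<open>Equivalence of the two norms\<close>

lemma
  assumes u: "u \<in> hybrid_space N \<alpha>" and "N \<ge> 1" and \<alpha>: "0 < \<alpha>" "\<alpha> < 1"
  shows energy_norm_le: "energy_norm N \<alpha> u \<le> sqrt (6 * real N) * star_norm N \<alpha> u"
    and energy_norm_ge: "sqrt (1 / (real N + 1) ^ 3) * star_norm N \<alpha> u \<le> energy_norm N \<alpha> u"
proof -
  define L where "L = (l2_norm (\<mu> N) u)\<^sup>2"
  define G where "G = enn2real (energy_on unit_lborel \<alpha> u)"
  define P where "P = (l2_norm unit_lborel (\<lambda>x. u x - unit_mean u))\<^sup>2"
  define D where "D = (\<Sum>k=2..N+1. (u (real k) - unit_mean u)\<^sup>2)"
  define E where "E = enn2real (energy N \<alpha> u)"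
  have nonneg: "0 \<le> L" "0 \<le> G" "0 \<le> P" "0 \<le> D"
    unfolding L_def G_def P_def D_def by (simp_all add: sum_nonneg del: sum.cl_ivl_Suc)
  have N: "1 \<le> real N" using assms by simp
  have star: "star_norm N \<alpha> u = sqrt (L + G + P + D)"
    unfolding star_norm_def L_def G_def P_def D_def gagliardo_sq_eq[OF hybrid_spaceD(1)[OF u]]
    by (simp only: power2_abs)
  have energy: "energy_norm N \<alpha> u = sqrt (L + E)"
    by (simp add: energy_norm_def L_def E_def)
  have E: "energy N \<alpha> u = ennreal E"
    using energy_finite[OF u \<alpha>] by (simp add: E_def)
  have E_nonneg: "0 \<le> E" by (simp add: E_def)
  have up: "E \<le> G + 2 * (real N * P + D) + 4 * real N * D"
    using energy_le[OF u \<alpha>] nonneg unfolding E G_def[symmetric] P_def[symmetric] D_def[symmetric]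
    by (subst (asm) ennreal_le_iff) simp_all
  have low: "G + 2 * ((real N * P + D) / (real N + 1) ^ 3) \<le> E"
    using energy_ge[OF u \<alpha>] E_nonneg unfolding E G_def[symmetric] P_def[symmetric] D_def[symmetric]
    by (subst (asm) ennreal_le_iff) simp_all
  have NP: "P \<le> real N * P" "D \<le> real N * D" "L \<le> real N * L" "G \<le> real N * G"
    using mult_right_mono[OF N] nonneg by fastforce+
  \<comment> \<open>The largest coefficient on the left is that of \<open>D\<close>, namely
    \<open>2 + 4 * N\<close>, which is at most \<open>6 * N\<close> because \<open>N\<close> is at
    least 1.\<close>
  have "L + E \<le> 6 * real N * (L + G + P + D)"
    using up NP nonneg by (simp add: distrib_left)
  then show "energy_norm N \<alpha> u \<le> sqrt (6 * real N) * star_norm N \<alpha> u"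
    unfolding star energy real_sqrt_mult[symmetric] by (rule real_sqrt_le_mono)
  \<comment> \<open>This is the constant of the mixed lower bound. As it is at most 1, it also
    serves for \<open>L\<close> and \<open>G\<close>, which occur with coefficient 1.\<close>
  define c where "c = 1 / (real N + 1) ^ 3"
  have c: "0 < c" "c \<le> 1" using N by (simp_all add: c_def one_le_power)
  have "c * L \<le> L" "c * G \<le> G" using c nonneg by (simp_all add: mult_left_le_one_le)
  moreover have "c * P + c * D \<le> 2 * (c * (real N * P + D))"
  proof -
    have "c * P \<le> c * (real N * P)" "0 \<le> c * D" "0 \<le> c * P"
      using c NP(1) nonneg by simp_all
    then show ?thesis unfolding distrib_left by linarith
  qed
  moreover have "2 * (c * (real N * P + D)) + G \<le> E"
    using low by (simp add: c_def)
  ultimately have "c * (L + G + P + D) \<le> L + E"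
    unfolding distrib_left by linarith
  then show "sqrt (1 / (real N + 1) ^ 3) * star_norm N \<alpha> u \<le> energy_norm N \<alpha> u"
    unfolding star energy real_sqrt_mult[symmetric] c_def by (rule real_sqrt_le_mono)
qed

theorem mainTheorem2:
  fixes N :: nat and \<alpha> :: real
  assumes "N \<ge> 2" and "0 < \<alpha>" and "\<alpha> < 1"
  shows "norm_mod_ae (\<mu> N) (hybrid_space N \<alpha>) (star_norm N \<alpha>) \<and>
    norm_mod_ae (\<mu> N) (hybrid_space N \<alpha>) (energy_norm N \<alpha>) \<and>
    (\<forall>u\<in>hybrid_space N \<alpha>. energy N \<alpha> u < \<infinity>) \<and>
    equivalent_on (hybrid_space N \<alpha>) (star_norm N \<alpha>) (energy_norm N \<alpha>)"
proof (intro conjI ballI)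
  show "norm_mod_ae (\<mu> N) (hybrid_space N \<alpha>) (star_norm N \<alpha>)"
  proof (rule norm_mod_ae_hybrid_spaceI[OF seminorm_star_norm])
    show "l2_norm (\<mu> N) u \<le> star_norm N \<alpha> u" for u
      unfolding star_norm_def
      \<comment> \<open>All other summands under the root are nonnegative.\<close>
      by (rule real_le_rsqrt) (simp add: add_nonneg_nonneg sum_nonneg add.assoc del: sum.cl_ivl_Suc)
  qed
  show "norm_mod_ae (\<mu> N) (hybrid_space N \<alpha>) (energy_norm N \<alpha>)"
  proof (rule norm_mod_ae_hybrid_spaceI[OF seminorm_energy_norm[OF assms(2,3)]])
    show "l2_norm (\<mu> N) u \<le> energy_norm N \<alpha> u" for u
      unfolding energy_norm_def by (rule real_le_rsqrt) simp
  qed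
  show "energy N \<alpha> u < \<infinity>" if "u \<in> hybrid_space N \<alpha>" for u
    using that assms(2,3) by (rule energy_finite)
  have "0 < sqrt (1 / (real N + 1) ^ 3)" "0 < sqrt (6 * real N)"
    using assms(1) by simp_all
  moreover have "N \<ge> 1" using assms(1) by simp
  ultimately show "equivalent_on (hybrid_space N \<alpha>) (star_norm N \<alpha>) (energy_norm N \<alpha>)"
    unfolding equivalent_on_def
    using energy_norm_ge[OF _ _ assms(2,3)] energy_norm_le[OF _ _ assms(2,3)] by meson
qed

end
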